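(* Let $D$ be sparse and let $t\in[0,1]$ be such that $C\cap(C+t)$ is not empty. If $t=0._n t_1\cdots t_{k-p}\overline{t_{k-p+1}\cdots t_k}$ for some period $p$ and integer $k\ge p$, then there exists a sparse digit set $E=\{0\le e_1<e_2<\cdots<e_r<n^{2p}\}$ with corresponding deleted digits Cantor set $C_{n^{2p},E}$ such that $C(t)$ consists of (is the union of) a finite number of translates of $\frac{1}{n^k}C_{n^{2p},E}$; these translates of $\frac1{n^k}C_{n^{2p},E}$ are disjoint, and in fact the corresponding translates of the convex hull of $\frac1{n^k}C_{n^{2p},E}$ are disjoint.
   Context: Let $n\ge 3$ be an integer and let $D=\{d_1<d_2<\cdots<d_m\}\subseteq\{0,1,\ldots,n-1\}$ be a digit set with $2\le m<n$ and $d_1=0$. For an integer $M\ge 2$ and a non-empty set $E$ of integers in $\{0,\ldots,M-1\}$ (possibly a single digit), $C_{M,E}:=\{\sum_{k=1}^\infty x_kM^{-k} : x_k\in E\text{ for all }k\ge1\}$; write $C=C_{n,D}$. A digit set $E$ is sparse if $|\delta-\delta'|\ge2$ for all $\delta\ne\delta'$ in $E-E=\{e-e' : e,e'\in E\}$. For $t\in\mathbb{R}$, $C+t:=\{x+t:x\in C\}$; if $C\cap(C+t)\neq\varnothing$ then $C(t):=(C\cap(C+t))-\inf(C\cap(C+t))$. The notation $0._n t_1t_2\cdots$ means $\sum_{k\ge1}t_kn^{-k}$ with digits $t_k\in\{0,\ldots,n-1\}$, and an overline denotes a block of digits repeated forever; $p\ge1$ is the length of the repeated block. *)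

theory Defs
  imports "HOL-Analysis.Analysis"
begin

text \<open>Digit sequences are indexed from 1; the value at 0 is ignored.\<close>

definition expansion :: "nat \<Rightarrow> (nat \<Rightarrow> int) \<Rightarrow> real" where
  "expansion M x = (\<Sum>k. real_of_int (x (Suc k)) / real M ^ Suc k)"

definition digit_set :: "nat \<Rightarrow> int set \<Rightarrow> bool" where
  "digit_set M E \<longleftrightarrow> E \<noteq> {} \<and> E \<subseteq> {0..<int M}"

text \<open>The intended use is \<open>M \<ge> 2\<close> and \<open>digit_set M E\<close>; then all the series converge.\<close>

definition cantor_set :: "nat \<Rightarrow> int set \<Rightarrow> real set" where
  "cantor_set M E = {expansion M x | x. \<forall>k\<ge>1. x k \<in> E}"

definition difference_set :: "int set \<Rightarrow> int set" where
  "difference_set E = {e - e' | e e'. e \<in> E \<and> e' \<in> E}"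

definition sparse_digits :: "int set \<Rightarrow> bool" where
  "sparse_digits E \<longleftrightarrow>
    (\<forall>\<delta>\<in>difference_set E. \<forall>\<delta>'\<in>difference_set E. \<delta> \<noteq> \<delta>' \<longrightarrow> \<bar>\<delta> - \<delta>'\<bar> \<ge> 2)"

definition translate :: "real \<Rightarrow> real set \<Rightarrow> real set" where
  "translate s A = (\<lambda>x. x + s) ` A"

text \<open>For \<open>C = cantor_set n D\<close>, the set \<open>C(t)\<close>. It is meaningful only when
  \<open>C\<close> meets \<open>C + t\<close>; otherwise it is empty.\<close>

definition normalized_intersection :: "real set \<Rightarrow> real \<Rightarrow> real set" where
  "normalized_intersection C t = translate (- Inf (C \<inter> translate t C)) (C \<inter> translate t C)"

definition scaled_cantor_set :: "nat \<Rightarrow> nat \<Rightarrow> nat \<Rightarrow> int set \<Rightarrow> real set" where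
  "scaled_cantor_set n k M E = (\<lambda>x. (1 / real n ^ k) * x) ` cantor_set M E"

end

theory Submission
  imports Defs
begin

text \<open>A point \<open>x\<close> of \<open>C \<inter> (C + t)\<close> yields an expansion of \<open>t\<close> with digits in \<open>D - D\<close>.
  By sparsity, the integers formed by the first \<open>M\<close> digits of two such expansions are equal or
  differ by at least 2, while the remaining tails lie in \<open>[-1, 1]\<close>. If for some \<open>M\<close> all
  tails are \<open>\<plusminus>1\<close>, then \<open>n^M x\<close> is always an integer and the intersection is
  finite, so \<open>E = {0}\<close> works. Otherwise \<open>t\<close> has a single expansion \<open>\<delta>\<close>, all its tails lie
  in \<open>(-1, 1)\<close>, and modulo 1 they agree with the tails of \<open>\<tau>\<close>. Hence two of the tails at
  \<open>k - p\<close>, \<open>k\<close>, \<open>k + p\<close> coincide, and uniqueness turns this into period \<open>2p\<close> for \<open>\<delta>\<close>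
  after position \<open>k\<close>. The digits of \<open>E\<close> are the blocks of length \<open>2p\<close> with entries in
  \<open>D \<inter> (D + \<delta>\<^sub>i)\<close>.\<close>

section \<open>Integer values of finite digit words, and their gaps under sparsity\<close>

primrec horner :: "nat \<Rightarrow> (nat \<Rightarrow> int) \<Rightarrow> nat \<Rightarrow> int" where
  "horner n x 0 = 0"
| "horner n x (Suc m) = int n * horner n x m + x (Suc m)"

definition digit_words :: "nat \<Rightarrow> (nat \<Rightarrow> int set) \<Rightarrow> nat \<Rightarrow> int set" where
  "digit_words n F m = {horner n x m | x. \<forall>i\<in>{1..m}. x i \<in> F i}"

text \<open>The allowed digits may vary with the position: for \<open>C \<inter> (C + t)\<close> the
  admissible digits at place \<open>i\<close> depend on the \<open>i\<close>-th digit of an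
  expansion of \<open>t\<close>.\<close>

definition digit_expansions :: "nat \<Rightarrow> (nat \<Rightarrow> int set) \<Rightarrow> real set" where
  "digit_expansions n F = {expansion n x | x. \<forall>i\<ge>1. x i \<in> F i}"

abbreviation bounded_digits :: "nat \<Rightarrow> (nat \<Rightarrow> int) \<Rightarrow> bool" where
  "bounded_digits n x \<equiv> \<forall>i\<ge>1. \<bar>x i\<bar> < int n"

lemma horner_cong:
  assumes "\<And>i. 1 \<le> i \<Longrightarrow> i \<le> m \<Longrightarrow> x i = y i"
  shows "horner n x m = horner n y m"
  using assms by (induction m) auto

lemma horner_diff: "horner n (\<lambda>i. x i - y i) m = horner n x m - horner n y m"
  by (induction m) (simp_all add: right_diff_distrib)

lemma horner_add_length:
  "horner n x (a + b) = int n ^ b * horner n x a + horner n (\<lambda>i. x (a + i)) b"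
  by (induction b) (auto simp: algebra_simps)

text \<open>Block \<open>j\<close> occupies positions \<open>(j - 1) * q + 1\<close> to
  \<open>j * q\<close>. Reading each block as one digit in base \<open>n ^ q\<close> is what relates
  \<open>C\<close> in base \<open>n\<close> to a Cantor set in base
  \<open>n ^ (2 * p)\<close>.\<close>

lemma horner_blocks:
  "horner (n ^ q) (\<lambda>j. horner n (\<lambda>i. x ((j - 1) * q + i)) q) m = horner n x (m * q)"
proof (induction m)
  case (Suc m)
  have "Suc m * q = m * q + q" by simp
  then show ?case
    by (simp only: horner.simps Suc horner_add_length diff_Suc_1 of_nat_power)
qed simp

lemma horner_bounds:
  assumes "\<And>i. 1 \<le> i \<Longrightarrow> i \<le> m \<Longrightarrow> x i \<in> {0..<int n}"
  shows "horner n x m \<in> {0..<int n ^ m}"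
  using assms
proof (induction m)
  case (Suc m)
  have h: "0 \<le> horner n x m" "horner n x m + 1 \<le> int n ^ m"
    using Suc by auto
  have x: "0 \<le> x (Suc m)" "x (Suc m) < int n"
    using Suc.prems[of "Suc m"] by auto
  have "int n * (horner n x m + 1) \<le> int n * int n ^ m"
    by (rule mult_left_mono[OF h(2)]) simp
  with h x show ?case by (simp add: algebra_simps)
qed simp

text \<open>Once a prefix has absolute value at least 2, a further digit cannot destroy this,
  because \<open>2 * n - 2 * (n - 1) = 2\<close>. As long as the prefix consists of zeros, the value
  is just the last digit, which is 0 or at least 2 in size.\<close>

lemma horner_gap:
  assumes "\<And>i. 1 \<le> i \<Longrightarrow> i \<le> m \<Longrightarrow> \<bar>w i\<bar> \<le> 2 * (int n - 1)"
    and "\<And>i. 1 \<le> i \<Longrightarrow> i \<le> m \<Longrightarrow> w i \<noteq> 0 \<Longrightarrow> 2 \<le> \<bar>w i\<bar>"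
  shows "(\<forall>i\<in>{1..m}. w i = 0) \<or> 2 \<le> \<bar>horner n w m\<bar>"
  using assms
proof (induction m)
  case (Suc m)
  have w: "\<bar>w (Suc m)\<bar> \<le> 2 * (int n - 1)" "w (Suc m) \<noteq> 0 \<Longrightarrow> 2 \<le> \<bar>w (Suc m)\<bar>"
    using Suc.prems[of "Suc m"] by auto
  have "(\<forall>i\<in>{1..m}. w i = 0) \<or> 2 \<le> \<bar>horner n w m\<bar>"
    using Suc by auto
  then show ?case
  proof
    assume z: "\<forall>i\<in>{1..m}. w i = 0"
    \<comment> \<open>The zero word is written as a difference so that \<open>horner_diff\<close>
      evaluates it to 0.\<close>
    have "horner n w m = horner n (\<lambda>i. w i - w i) m"
      using z by (intro horner_cong) auto
    also have "\<dots> = 0" by (simp only: horner_diff)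
    finally have "horner n w (Suc m) = w (Suc m)" by simp
    with w z show ?thesis by (cases "w (Suc m) = 0") (auto simp: le_Suc_eq)
  next
    assume "2 \<le> \<bar>horner n w m\<bar>"
    then have "int n * 2 \<le> int n * \<bar>horner n w m\<bar>"
      by (intro mult_left_mono) auto
    also have "\<dots> = \<bar>int n * horner n w m\<bar>" by (simp add: abs_mult)
    also have "\<dots> \<le> \<bar>horner n w (Suc m)\<bar> + \<bar>w (Suc m)\<bar>"
      using abs_triangle_ineq4[of "horner n w (Suc m)" "w (Suc m)"] by simp
    finally have "2 \<le> \<bar>horner n w (Suc m)\<bar>"
      using w(1) unfolding mult.commute[of "int n" 2] right_diff_distrib by simp
    then show ?thesis ..
  qed
qed simp

lemma difference_set_abs_less:
  assumes "digit_set n D" "d \<in> difference_set D"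
  shows "\<bar>d\<bar> < int n"
proof -
  obtain a b where "d = a - b" "a \<in> D" "b \<in> D"
    using assms(2) by (auto simp: difference_set_def)
  moreover from this have "a \<in> {0..<int n}" "b \<in> {0..<int n}"
    using assms(1) by (auto simp: digit_set_def)
  ultimately show ?thesis by auto
qed

lemma difference_setI: "a \<in> D \<Longrightarrow> b \<in> D \<Longrightarrow> a - b \<in> difference_set D"
  by (auto simp: difference_set_def)

text \<open>The digitwise differences \<open>x i - y i\<close> satisfy both hypotheses of
  \<open>horner_gap\<close>: elements of \<open>D - D\<close> are at most \<open>n - 1\<close> in
  size, and sparsity keeps distinct ones at least 2 apart.\<close>

lemma sparse_horner_gap:
  assumes "digit_set n D" "sparse_digits D"
    and x: "\<And>i. 1 \<le> i \<Longrightarrow> i \<le> m \<Longrightarrow> x i \<in> difference_set D"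
    and y: "\<And>i. 1 \<le> i \<Longrightarrow> i \<le> m \<Longrightarrow> y i \<in> difference_set D"
  shows "(\<forall>i\<in>{1..m}. x i = y i) \<or> 2 \<le> \<bar>horner n x m - horner n y m\<bar>"
proof -
  have "(\<forall>i\<in>{1..m}. x i - y i = 0) \<or> 2 \<le> \<bar>horner n (\<lambda>i. x i - y i) m\<bar>"
  proof (rule horner_gap)
    fix i assume i: "1 \<le> i" "i \<le> m"
    show "\<bar>x i - y i\<bar> \<le> 2 * (int n - 1)"
      using difference_set_abs_less[OF assms(1) x[OF i]]
        difference_set_abs_less[OF assms(1) y[OF i]] by simp
    show "x i - y i \<noteq> 0 \<Longrightarrow> 2 \<le> \<bar>x i - y i\<bar>"
      using assms(2) x[OF i] y[OF i] by (auto simp: sparse_digits_def)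
  qed
  then show ?thesis by (simp add: horner_diff)
qed

lemma digit_set_digit_words:
  assumes "\<And>i. F i \<subseteq> {0..<int n}" "\<And>i. 1 \<le> i \<Longrightarrow> F i \<noteq> {}"
  shows "digit_set (n ^ m) (digit_words n F m)"
proof -
  have "\<forall>i. \<exists>a. 1 \<le> i \<longrightarrow> a \<in> F i" using assms(2) by blast
  then obtain x where "\<forall>i. 1 \<le> i \<longrightarrow> x i \<in> F i" by metis
  then have "horner n x m \<in> digit_words n F m" by (auto simp: digit_words_def)
  moreover have "digit_words n F m \<subseteq> {0..<int (n ^ m)}"
  proof
    fix e assume "e \<in> digit_words n F m"
    then obtain x where x: "e = horner n x m" "\<forall>i\<in>{1..m}. x i \<in> F i"
      by (auto simp: digit_words_def)
    have "horner n x m \<in> {0..<int n ^ m}"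
      by (rule horner_bounds) (use x(2) assms(1) in force)
    then show "e \<in> {0..<int (n ^ m)}" using x(1) by simp
  qed
  ultimately show ?thesis by (auto simp: digit_set_def)
qed

text \<open>A difference of two words is itself a word with digits in \<open>D - D\<close>, so two
  unequal differences come from different words over \<open>D - D\<close>, and
  \<open>sparse_horner_gap\<close> separates their values.\<close>

lemma sparse_digit_words:
  assumes D: "digit_set n D" "sparse_digits D" and F: "\<And>i. F i \<subseteq> D"
  shows "sparse_digits (digit_words n F m)"
  unfolding sparse_digits_def
proof (intro ballI impI)
  have *: "\<exists>w. d = horner n w m \<and> (\<forall>i\<in>{1..m}. w i \<in> difference_set D)"
    if d: "d \<in> difference_set (digit_words n F m)" for d
  proof -
    obtain x y where "d = horner n x m - horner n y m"
      and xy: "\<forall>i\<in>{1..m}. x i \<in> F i" "\<forall>i\<in>{1..m}. y i \<in> F i"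
      using d unfolding difference_set_def digit_words_def by blast
    then have "d = horner n (\<lambda>i. x i - y i) m" by (simp add: horner_diff)
    moreover have "\<forall>i\<in>{1..m}. x i - y i \<in> difference_set D"
      using xy F by (blast intro: difference_setI)
    ultimately show ?thesis by blast
  qed
  fix d d' assume d: "d \<in> difference_set (digit_words n F m)"
    "d' \<in> difference_set (digit_words n F m)" "d \<noteq> d'"
  obtain w where w: "d = horner n w m" "\<forall>i\<in>{1..m}. w i \<in> difference_set D"
    using *[OF d(1)] by blast
  obtain w' where w': "d' = horner n w' m" "\<forall>i\<in>{1..m}. w' i \<in> difference_set D"
    using *[OF d(2)] by blast
  have "(\<forall>i\<in>{1..m}. w i = w' i) \<or> 2 \<le> \<bar>horner n w m - horner n w' m\<bar>"
    by (rule sparse_horner_gap[OF D]) (use w w' in auto)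
  moreover have "\<not> (\<forall>i\<in>{1..m}. w i = w' i)"
    using d(3) w(1) w'(1) horner_cong[of m w w' n] by (metis atLeastAtMost_iff)
  ultimately show "2 \<le> \<bar>d - d'\<bar>" unfolding w(1) w'(1) by argo
qed

section \<open>Convergence, bounds and splitting of infinite expansions\<close>

lemma expansion_cong:
  assumes "\<And>i. 1 \<le> i \<Longrightarrow> x i = y i"
  shows "expansion n x = expansion n y"
  unfolding expansion_def by (simp add: assms)

lemma expansion_zero [simp]: "expansion n (\<lambda>_. 0) = 0"
  by (simp add: expansion_def)

text \<open>This is the convergent majorant for all expansions with digits below \<open>n\<close> in
  absolute value, and the source of the bound 1 on tails.\<close>

lemma sums_top_digits:
  assumes "2 \<le> n"
  shows "(\<lambda>k. (real n - 1) / real n ^ Suc k) sums 1"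
proof -
  have "(\<lambda>k. (1 / real n) ^ k) sums (1 / (1 - 1 / real n))"
    using assms by (intro geometric_sums) auto
  from sums_mult[OF this, of "(real n - 1) / real n"]
  show ?thesis using assms by (simp add: power_divide field_simps)
qed

lemma expansion_term_le:
  assumes "2 \<le> n" "\<bar>a\<bar> < int n"
  shows "\<bar>real_of_int a / real n ^ m\<bar> \<le> (real n - 1) / real n ^ m"
proof -
  have "\<bar>real_of_int a\<bar> \<le> real n - 1" using assms(2) by linarith
  then show ?thesis using assms by (simp add: abs_divide divide_right_mono)
qed

lemma summable_expansion:
  assumes "2 \<le> n" "bounded_digits n x"
  shows "summable (\<lambda>k. real_of_int (x (Suc k)) / real n ^ Suc k)"
proof (rule summable_comparison_test')
  show "summable (\<lambda>k. (real n - 1) / real n ^ Suc k)"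
    by (rule sums_summable[OF sums_top_digits[OF assms(1)]])
  show "norm (real_of_int (x (Suc k)) / real n ^ Suc k) \<le> (real n - 1) / real n ^ Suc k" for k
    unfolding real_norm_def by (rule expansion_term_le) (use assms in simp_all)
qed

lemma abs_expansion_le_1:
  assumes "2 \<le> n" "bounded_digits n x"
  shows "\<bar>expansion n x\<bar> \<le> 1"
proof -
  note t = sums_top_digits[OF assms(1)] and s = summable_expansion[OF assms]
  have le: "\<bar>real_of_int (x (Suc k)) / real n ^ Suc k\<bar> \<le> (real n - 1) / real n ^ Suc k" for k
    by (rule expansion_term_le) (use assms in simp_all)
  let ?b = "\<lambda>k. (real n - 1) / real n ^ Suc k"
  have "expansion n x \<le> suminf ?b"
    unfolding expansion_def
    by (rule suminf_le[OF _ s sums_summable[OF t]]) (rule abs_le_D1[OF le])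
  moreover have "- expansion n x \<le> suminf ?b"
    unfolding expansion_def suminf_minus[OF s, symmetric]
    by (rule suminf_le[OF _ summable_minus[OF s] sums_summable[OF t]]) (rule abs_le_D2[OF le])
  moreover have "suminf ?b = 1" by (rule sums_unique[OF t, symmetric])
  ultimately show ?thesis by simp
qed

lemma expansion_nonneg:
  assumes "2 \<le> n" "\<And>i. 1 \<le> i \<Longrightarrow> x i \<in> {0..<int n}"
  shows "0 \<le> expansion n x"
proof -
  have "summable (\<lambda>k. real_of_int (x (Suc k)) / real n ^ Suc k)"
    by (rule summable_expansion[OF assms(1)]) (use assms(2) in force)
  then show ?thesis unfolding expansion_def
    by (rule suminf_nonneg) (use assms(2) in force)
qed

lemma expansion_diff:
  assumes "2 \<le> n" "bounded_digits n x" "bounded_digits n y"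
  shows "expansion n (\<lambda>i. x i - y i) = expansion n x - expansion n y"
  unfolding expansion_def
  using suminf_diff[OF summable_expansion[OF assms(1,2)] summable_expansion[OF assms(1,3)]]
  by (simp add: diff_divide_distrib)

lemma sum_digits_eq_horner:
  assumes "n > 0"
  shows "(\<Sum>k<m. real_of_int (x (Suc k)) / real n ^ Suc k) = real_of_int (horner n x m) / real n ^ m"
  using assms by (induction m) (auto simp: field_simps)

lemma horner_tendsto_expansion:
  assumes "2 \<le> n" "bounded_digits n x"
  shows "(\<lambda>m. real_of_int (horner n x m) / real n ^ m) \<longlonglongrightarrow> expansion n x"
proof -
  have "real_of_int (horner n x m) / real n ^ m =
      (\<Sum>k<m. real_of_int (x (Suc k)) / real n ^ Suc k)" for m
    by (rule sum_digits_eq_horner[symmetric]) (use assms(1) in simp)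
  then show ?thesis
    using summable_LIMSEQ[OF summable_expansion[OF assms]] by (simp only: expansion_def)
qed

text \<open>Multiplying by \<open>n ^ m\<close> moves the first \<open>m\<close> digits before the
  radix point. Two expansions of one number thus have integer words and tails with equal sums, which
  lets bounds on tails control words.\<close>

lemma expansion_split:
  assumes "2 \<le> n" "bounded_digits n x"
  shows "real n ^ m * expansion n x =
    real_of_int (horner n x m) + expansion n (\<lambda>i. x (m + i))"
proof -
  let ?f = "\<lambda>k. real_of_int (x (Suc k)) / real n ^ Suc k"
  have "expansion n (\<lambda>i. x (m + i)) = (\<Sum>k. real n ^ m * ?f (k + m))"
    unfolding expansion_def using assms(1) by (simp add: power_add field_simps)
  also have "\<dots> = real n ^ m * (\<Sum>k. ?f (k + m))"
    by (rule suminf_mult) (rule summable_ignore_initial_segment[OF summable_expansion[OF assms]])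
  also have "(\<Sum>k. ?f (k + m)) = expansion n x - real_of_int (horner n x m) / real n ^ m"
    using suminf_split_initial_segment[OF summable_expansion[OF assms], of m]
      sum_digits_eq_horner[of n x m] assms(1)
    by (simp add: expansion_def)
  finally show ?thesis using assms(1) by (simp add: right_diff_distrib)
qed

section \<open>Sets of expansions with position-dependent digits\<close>

lemma digit_expansions_subset:
  assumes "2 \<le> n" "\<And>i. F i \<subseteq> {0..<int n}"
  shows "digit_expansions n F \<subseteq> {0..1}"
proof
  fix c assume "c \<in> digit_expansions n F"
  then obtain x where x: "c = expansion n x" "\<And>i. 1 \<le> i \<Longrightarrow> x i \<in> F i"
    by (auto simp: digit_expansions_def)
  have d: "x i \<in> {0..<int n}" if "1 \<le> i" for i using x(2)[OF that] assms(2) by blast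
  have "\<bar>expansion n x\<bar> \<le> 1"
    by (rule abs_expansion_le_1[OF assms(1)]) (use d in force)
  with expansion_nonneg[OF assms(1) d] x(1) show "c \<in> {0..1}" by simp
qed

text \<open>The constraints at different positions are independent, so every admissible prefix may
  be followed by every admissible tail.\<close>

lemma digit_expansions_split:
  assumes "2 \<le> n" "\<And>i. F i \<subseteq> {0..<int n}"
  shows "digit_expansions n F =
    {(real_of_int N + c) / real n ^ m | N c.
      N \<in> digit_words n F m \<and> c \<in> digit_expansions n (\<lambda>i. F (m + i))}"
    (is "_ = ?R")
proof (intro equalityI subsetI)
  have split: "expansion n x = (real_of_int (horner n x m) + expansion n (\<lambda>i. x (m + i))) / real n ^ m"
    if "\<And>i. 1 \<le> i \<Longrightarrow> x i \<in> F i" for x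
  proof -
    have "real n ^ m * expansion n x = real_of_int (horner n x m) + expansion n (\<lambda>i. x (m + i))"
      by (rule expansion_split[OF assms(1)]) (use that assms(2) in force)
    then show ?thesis using assms(1) by (simp add: field_simps)
  qed
  {
    fix a assume "a \<in> digit_expansions n F"
    then obtain x where x: "a = expansion n x" "\<And>i. 1 \<le> i \<Longrightarrow> x i \<in> F i"
      by (auto simp: digit_expansions_def)
    have "horner n x m \<in> digit_words n F m" using x(2) by (auto simp: digit_words_def)
    moreover have "expansion n (\<lambda>i. x (m + i)) \<in> digit_expansions n (\<lambda>i. F (m + i))"
      using x(2) by (auto simp: digit_expansions_def)
    ultimately show "a \<in> ?R" using split[OF x(2)] x(1) by blast
  next
    fix a assume "a \<in> ?R"
    then obtain x y
      where a: "a = (real_of_int (horner n x m) + expansion n y) / real n ^ m"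
        and x: "\<forall>i\<in>{1..m}. x i \<in> F i" and y: "\<forall>i\<ge>1. y i \<in> F (m + i)"
      by (auto simp: digit_words_def digit_expansions_def)
    define z where "z i = (if i \<le> m then x i else y (i - m))" for i
    have z: "z i \<in> F i" if "1 \<le> i" for i
      using x y[rule_format, of "i - m"] that by (auto simp: z_def)
    have "horner n z m = horner n x m" by (rule horner_cong) (simp add: z_def)
    moreover have "expansion n (\<lambda>i. z (m + i)) = expansion n y"
      by (rule expansion_cong) (simp add: z_def)
    ultimately have "a = expansion n z" using split[OF z] a by simp
    then show "a \<in> digit_expansions n F" using z by (auto simp: digit_expansions_def)
  }
qed

text \<open>Periodicity makes every block of \<open>q\<close> places admit the same words. The
  partial sums in base \<open>n ^ q\<close> form the subsequence at multiples of \<open>q\<close> of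
  those in base \<open>n\<close>, so regrouping preserves the value.\<close>

lemma cantor_set_digit_words:
  assumes n: "2 \<le> n" and q: "1 \<le> q" and F: "\<And>i. F i \<subseteq> {0..<int n}"
    and per: "\<And>i. 1 \<le> i \<Longrightarrow> F (i + q) = F i"
  shows "cantor_set (n ^ q) (digit_words n F q) = digit_expansions n F"
proof -
  have per': "F (j * q + i) = F i" if "1 \<le> i" for i j
  proof (induction j)
    case (Suc j)
    then show ?case using per[of "j * q + i"] that by (simp add: algebra_simps)
  qed simp
  have nq: "2 \<le> n ^ q"
    using n q self_le_power[of n q] by linarith
  have blocks: "expansion (n ^ q) y = expansion n x"
    if x: "\<And>i. 1 \<le> i \<Longrightarrow> x i \<in> F i"
      and y: "\<And>j. 1 \<le> j \<Longrightarrow> y j = horner n (\<lambda>i. x ((j - 1) * q + i)) q" for x y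
  proof -
    have dx: "x i \<in> {0..<int n}" if "1 \<le> i" for i using x[OF that] F by blast
    have dy: "bounded_digits (n ^ q) y"
    proof (intro allI impI)
      fix j :: nat assume j: "1 \<le> j"
      have "horner n (\<lambda>i. x ((j - 1) * q + i)) q \<in> {0..<int n ^ q}"
        by (rule horner_bounds) (use dx in simp)
      then show "\<bar>y j\<bar> < int (n ^ q)" using y[OF j] by simp
    qed
    have "horner (n ^ q) y m = horner n x (m * q)" for m
      unfolding horner_blocks[symmetric] by (rule horner_cong) (rule y)
    then have "(\<lambda>m. real_of_int (horner n x (m * q)) / real n ^ (m * q)) \<longlonglongrightarrow> expansion (n ^ q) y"
      using horner_tendsto_expansion[OF nq dy] by (simp add: power_mult[symmetric] mult.commute)
    moreover have "(\<lambda>m. real_of_int (horner n x m) / real n ^ m) \<longlonglongrightarrow> expansion n x"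
      by (rule horner_tendsto_expansion[OF n]) (use dx in force)
    from LIMSEQ_subseq_LIMSEQ[OF this, of "\<lambda>m. m * q"]
    have "(\<lambda>m. real_of_int (horner n x (m * q)) / real n ^ (m * q)) \<longlonglongrightarrow> expansion n x"
      using q by (simp add: strict_mono_def o_def)
    ultimately show ?thesis by (rule LIMSEQ_unique)
  qed
  show ?thesis
  proof (intro equalityI subsetI)
    fix a assume "a \<in> cantor_set (n ^ q) (digit_words n F q)"
    then obtain y where a: "a = expansion (n ^ q) y" and y: "\<forall>j\<ge>1. y j \<in> digit_words n F q"
      by (auto simp: cantor_set_def)
    then have "\<forall>j. \<exists>z. 1 \<le> j \<longrightarrow> y j = horner n z q \<and> (\<forall>i\<in>{1..q}. z i \<in> F i)"
      by (auto simp: digit_words_def)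
    then obtain z where z: "\<And>j. 1 \<le> j \<Longrightarrow> y j = horner n (z j) q \<and> (\<forall>i\<in>{1..q}. z j i \<in> F i)"
      by metis
    \<comment> \<open>This undoes the regrouping. Positions start at 1, hence the shift by one
      before division and the \<open>Suc\<close> after it.\<close>
    define x where "x i = z (Suc ((i - 1) div q)) (Suc ((i - 1) mod q))" for i
    have "x i \<in> F i" if "1 \<le> i" for i
    proof -
      have "Suc ((i - 1) mod q) \<in> {1..q}" using q by (simp add: Suc_leI)
      then have "x i \<in> F (Suc ((i - 1) mod q))" using z[of "Suc ((i - 1) div q)"] by (simp add: x_def)
      also have "F (Suc ((i - 1) mod q)) = F ((i - 1) div q * q + Suc ((i - 1) mod q))"
        by (rule per'[symmetric]) simp
      also have "(i - 1) div q * q + Suc ((i - 1) mod q) = i" using that by simp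
      finally show ?thesis .
    qed
    moreover have "y j = horner n (\<lambda>i. x ((j - 1) * q + i)) q" if j: "1 \<le> j" for j
    proof -
      have "horner n (z j) q = horner n (\<lambda>i. x ((j - 1) * q + i)) q"
      proof (rule horner_cong)
        fix i assume i: "1 \<le> i" "i \<le> q"
        obtain i' j' where e: "i = Suc i'" "j = Suc j'"
          using i(1) j by (metis Suc_le_D One_nat_def)
        then have "(i' + j' * q) div q = j'" "(i' + j' * q) mod q = i'" using i by simp_all
        then show "z j i = x ((j - 1) * q + i)" by (simp add: x_def e add.commute)
      qed
      then show ?thesis using z[OF j] by simp
    qed
    ultimately show "a \<in> digit_expansions n F"
      using blocks[of x y] a by (auto simp: digit_expansions_def)
  next
    fix a assume "a \<in> digit_expansions n F"
    then obtain x where a: "a = expansion n x" and x: "\<And>i. 1 \<le> i \<Longrightarrow> x i \<in> F i"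
      by (auto simp: digit_expansions_def)
    let ?y = "\<lambda>j. horner n (\<lambda>i. x ((j - 1) * q + i)) q"
    have "?y j \<in> digit_words n F q" for j
    proof -
      have "x ((j - 1) * q + i) \<in> F i" if "1 \<le> i" for i
        using x[of "(j - 1) * q + i"] per'[OF that] that by simp
      then show ?thesis unfolding digit_words_def by auto
    qed
    moreover have "a = expansion (n ^ q) ?y"
      unfolding a by (rule blocks[symmetric]) (use x in auto)
    ultimately show "a \<in> cantor_set (n ^ q) (digit_words n F q)"
      by (auto simp: cantor_set_def)
  qed
qed

section \<open>Expansions of \<open>t\<close> with digits in \<open>D - D\<close>: uniqueness and
  periodicity\<close>

definition expands_diff :: "nat \<Rightarrow> int set \<Rightarrow> real \<Rightarrow> (nat \<Rightarrow> int) \<Rightarrow> bool" where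
  "expands_diff n D t \<delta> \<longleftrightarrow> (\<forall>i\<ge>1. \<delta> i \<in> difference_set D) \<and> expansion n \<delta> = t"

lemma expands_diff_bound:
  assumes "digit_set n D" "expands_diff n D t \<delta>"
  shows "bounded_digits n \<delta>"
  using difference_set_abs_less[OF assms(1)] assms(2) by (simp add: expands_diff_def)

lemma intersection_translateE:
  assumes "2 \<le> n" "digit_set n D" "a \<in> cantor_set n D \<inter> translate t (cantor_set n D)"
  obtains x y where "a = expansion n x" "\<And>i. 1 \<le> i \<Longrightarrow> x i \<in> D" "\<And>i. 1 \<le> i \<Longrightarrow> y i \<in> D"
    "expands_diff n D t (\<lambda>i. x i - y i)"
proof -
  obtain x y where xy: "a = expansion n x" "a = expansion n y + t"
    and x: "\<And>i. 1 \<le> i \<Longrightarrow> x i \<in> D" and y: "\<And>i. 1 \<le> i \<Longrightarrow> y i \<in> D"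
    using assms(3) by (auto simp: cantor_set_def translate_def)
  have "expansion n (\<lambda>i. x i - y i) = expansion n x - expansion n y"
    by (rule expansion_diff[OF assms(1)]) (use x y assms(2) in \<open>force simp: digit_set_def\<close>)+
  then have "expands_diff n D t (\<lambda>i. x i - y i)"
    using xy x y by (auto simp: expands_diff_def intro: difference_setI)
  with that x y xy show ?thesis by blast
qed

text \<open>The tails of \<open>x\<close> and \<open>y\<close> lie in [0, 1], so a difference of
  size at least 1 forces each to be 0 or 1, and \<open>n ^ m * a\<close> is an integer. It is used
  in contrapositive form: an infinite intersection supplies, for each \<open>m\<close>, an expansion
  whose tail at \<open>m\<close> lies strictly inside (-1, 1).\<close>

lemma finite_intersection_if_unit_tails:
  assumes n: "2 \<le> n" and D: "digit_set n D"
    and unit: "\<And>\<delta>. expands_diff n D t \<delta> \<Longrightarrow> 1 \<le> \<bar>expansion n (\<lambda>i. \<delta> (m + i))\<bar>"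
  shows "finite (cantor_set n D \<inter> translate t (cantor_set n D))"
proof (rule finite_subset)
  let ?f = "\<lambda>N. real_of_int N / real n ^ m"
  \<comment> \<open>The right endpoint is included because a tail equal to 1 raises the integer by
    one.\<close>
  show "finite (?f ` {0..int n ^ m})" by simp
  show "cantor_set n D \<inter> translate t (cantor_set n D) \<subseteq> ?f ` {0..int n ^ m}"
  proof
    fix a assume a: "a \<in> cantor_set n D \<inter> translate t (cantor_set n D)"
    obtain x y where xy: "a = expansion n x" "\<And>i. 1 \<le> i \<Longrightarrow> x i \<in> D" "\<And>i. 1 \<le> i \<Longrightarrow> y i \<in> D"
      and ex: "expands_diff n D t (\<lambda>i. x i - y i)"
      using intersection_translateE[OF n D a] by metis
    have x: "x i \<in> {0..<int n}" if "1 \<le> i" for i using xy(2)[OF that] D by (auto simp: digit_set_def)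
    have y: "y i \<in> {0..<int n}" if "1 \<le> i" for i using xy(3)[OF that] D by (auto simp: digit_set_def)
    let ?u = "expansion n (\<lambda>i. x (m + i))" and ?v = "expansion n (\<lambda>i. y (m + i))"
    have "expansion n (\<lambda>i. x (m + i) - y (m + i)) = ?u - ?v"
      by (rule expansion_diff[OF n]) (use x y in force)+
    then have "1 \<le> \<bar>?u - ?v\<bar>" using unit[OF ex] by simp
    moreover have "0 \<le> ?u" "0 \<le> ?v" using x y by (auto intro!: expansion_nonneg n)
    moreover have "\<bar>?u\<bar> \<le> 1" "\<bar>?v\<bar> \<le> 1"
      by (rule abs_expansion_le_1[OF n]; use x y in force)+
    ultimately have "?u = 0 \<or> ?u = 1" by linarith
    moreover have "real n ^ m * a = real_of_int (horner n x m) + ?u"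
      unfolding xy(1) by (rule expansion_split[OF n]) (use x in force)
    ultimately have "real n ^ m * a = real_of_int (horner n x m) \<or>
        real n ^ m * a = real_of_int (horner n x m + 1)"
      by auto
    then obtain N where N: "N = horner n x m \<or> N = horner n x m + 1" "real n ^ m * a = real_of_int N"
      by blast
    have "horner n x m \<in> {0..<int n ^ m}" by (rule horner_bounds) (use x in simp)
    with N(1) have "N \<in> {0..int n ^ m}" by auto
    moreover have "a = ?f N" using N(2) n by (simp add: field_simps)
    ultimately show "a \<in> ?f ` {0..int n ^ m}" by blast
  qed
qed

text \<open>Both expansions are compared with a third, \<open>w\<close>, chosen for the given
  \<open>i\<close> with tail strictly inside (-1, 1). Any other tail is at most 1 in size, so the
  integer words up to \<open>i\<close> differ by less than 2, and sparsity makes them equal.\<close>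

lemma expands_diff_unique:
  assumes n: "2 \<le> n" and D: "digit_set n D" "sparse_digits D"
    and inf: "infinite (cantor_set n D \<inter> translate t (cantor_set n D))"
    and \<delta>: "expands_diff n D t \<delta>" and \<epsilon>: "expands_diff n D t \<epsilon>" and i: "1 \<le> i"
  shows "\<delta> i = \<epsilon> i"
proof -
  obtain w where w: "expands_diff n D t w" "\<bar>expansion n (\<lambda>j. w (i + j))\<bar> < 1"
    using finite_intersection_if_unit_tails[OF n D(1), of t i] inf by (meson not_le)
  have "\<epsilon> i = w i" if \<epsilon>: "expands_diff n D t \<epsilon>" for \<epsilon>
  proof -
    have e: "(\<forall>j\<in>{1..i}. \<epsilon> j = w j) \<or> 2 \<le> \<bar>horner n \<epsilon> i - horner n w i\<bar>"
      by (rule sparse_horner_gap[OF D]) (use \<epsilon> w in \<open>auto simp: expands_diff_def\<close>)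
    note b = expands_diff_bound[OF D(1) \<epsilon>] expands_diff_bound[OF D(1) w(1)]
    have "\<bar>expansion n (\<lambda>j. \<epsilon> (i + j))\<bar> \<le> 1"
      by (rule abs_expansion_le_1[OF n]) (use b in simp)
    moreover have "real_of_int (horner n \<epsilon> i) + expansion n (\<lambda>j. \<epsilon> (i + j)) =
        real_of_int (horner n w i) + expansion n (\<lambda>j. w (i + j))"
      using expansion_split[OF n b(1), of i] expansion_split[OF n b(2), of i] \<epsilon> w
      by (simp add: expands_diff_def)
    ultimately have "\<bar>real_of_int (horner n \<epsilon> i - horner n w i)\<bar> < 2"
      using w(2) by (simp add: abs_if split: if_splits)
    then have "\<bar>horner n \<epsilon> i - horner n w i\<bar> < 2" by linarith
    with e i show ?thesis by auto
  qed
  from this[OF \<delta>] this[OF \<epsilon>] show ?thesis by simp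
qed

text \<open>Replacing the tail after \<open>a\<close> by the equal-valued tail after
  \<open>b\<close> gives another expansion of \<open>t\<close>; uniqueness then identifies the
  digits.\<close>

lemma expands_diff_tails_eq:
  assumes n: "2 \<le> n" and D: "digit_set n D" "sparse_digits D"
    and inf: "infinite (cantor_set n D \<inter> translate t (cantor_set n D))"
    and \<delta>: "expands_diff n D t \<delta>"
    and eq: "expansion n (\<lambda>i. \<delta> (a + i)) = expansion n (\<lambda>i. \<delta> (b + i))" and i: "1 \<le> i"
  shows "\<delta> (a + i) = \<delta> (b + i)"
proof -
  define \<epsilon> where "\<epsilon> j = (if j \<le> a then \<delta> j else \<delta> (b + (j - a)))" for j
  have \<epsilon>: "\<epsilon> j \<in> difference_set D" if "1 \<le> j" for j
    using \<delta> that by (auto simp: expands_diff_def \<epsilon>_def)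
  have "real n ^ a * expansion n \<epsilon> = real_of_int (horner n \<epsilon> a) + expansion n (\<lambda>i. \<epsilon> (a + i))"
    by (rule expansion_split[OF n]) (use difference_set_abs_less[OF D(1) \<epsilon>] in blast)
  also have "horner n \<epsilon> a = horner n \<delta> a" by (rule horner_cong) (simp add: \<epsilon>_def)
  also have "expansion n (\<lambda>i. \<epsilon> (a + i)) = expansion n (\<lambda>i. \<delta> (b + i))"
    by (rule expansion_cong) (simp add: \<epsilon>_def)
  also have "real_of_int (horner n \<delta> a) + \<dots> = real n ^ a * expansion n \<delta>"
    using expansion_split[OF n expands_diff_bound[OF D(1) \<delta>], of a] eq by simp
  finally have "expansion n \<epsilon> = expansion n \<delta>" using n by simp
  then have "expands_diff n D t \<epsilon>" using \<delta> \<epsilon> by (simp add: expands_diff_def)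
  from expands_diff_unique[OF n D inf \<delta> this, of "a + i"] i show ?thesis by (simp add: \<epsilon>_def)
qed

text \<open>The witness with a short tail depends on \<open>m\<close>, but by uniqueness it has the
  same digits as \<open>\<delta>\<close>.\<close>

lemma abs_tail_less_1:
  assumes n: "2 \<le> n" and D: "digit_set n D" "sparse_digits D"
    and inf: "infinite (cantor_set n D \<inter> translate t (cantor_set n D))"
    and \<delta>: "expands_diff n D t \<delta>"
  shows "\<bar>expansion n (\<lambda>i. \<delta> (m + i))\<bar> < 1"
proof -
  obtain w where w: "expands_diff n D t w" "\<bar>expansion n (\<lambda>j. w (m + j))\<bar> < 1"
    using finite_intersection_if_unit_tails[OF n D(1), of t m] inf by (meson not_le)
  have "expansion n (\<lambda>i. \<delta> (m + i)) = expansion n (\<lambda>i. w (m + i))"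
    by (rule expansion_cong) (rule expands_diff_unique[OF n D inf \<delta> w(1)], simp)
  with w(2) show ?thesis by simp
qed

lemma expands_diff_periodic:
  assumes n: "2 \<le> n" and D: "digit_set n D" "sparse_digits D"
    and inf: "infinite (cantor_set n D \<inter> translate t (cantor_set n D))"
    and \<delta>: "expands_diff n D t \<delta>" and pk: "p \<le> k"
    and \<tau>: "\<And>j. 1 \<le> j \<Longrightarrow> \<tau> j \<in> {0..<int n}" "\<And>j. j > k - p \<Longrightarrow> \<tau> (j + p) = \<tau> j"
    and t: "t = expansion n \<tau>" and i: "1 \<le> i"
  shows "\<delta> (k + (i + 2 * p)) = \<delta> (k + i)"
proof -
  let ?u = "\<lambda>m. expansion n (\<lambda>i. \<delta> (m + i))" and ?v = "\<lambda>m. expansion n (\<lambda>i. \<tau> (m + i))"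
  have \<tau>': "bounded_digits n \<tau>" using \<tau>(1) by force
  have v: "?v (m + p) = ?v m" if "k - p \<le> m" for m
  proof (rule expansion_cong)
    fix i :: nat assume "1 \<le> i"
    then show "\<tau> (m + p + i) = \<tau> (m + i)" using \<tau>(2)[of "m + i"] that by (simp add: add.commute add.left_commute)
  qed
  have int: "\<exists>z::int. ?u m = ?v m + z" for m
  proof -
    \<comment> \<open>Both sides are \<open>n ^ m * t\<close>, so the two tails differ by an
      integer.\<close>
    have "horner n \<delta> m + ?u m = horner n \<tau> m + ?v m"
      using expansion_split[OF n expands_diff_bound[OF D(1) \<delta>], of m]
        expansion_split[OF n \<tau>', of m] t \<delta> by (simp add: expands_diff_def)
    then have "?u m = ?v m + real_of_int (horner n \<tau> m - horner n \<delta> m)" by simp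
    then show ?thesis by blast
  qed
  have vs: "?v k = ?v (k - p)" "?v (k + p) = ?v (k - p)"
    using v[of "k - p"] v[of k] pk by simp_all
  obtain z0 z1 z2 :: int where z: "?u (k - p) = ?v (k - p) + z0" "?u k = ?v k + z1"
    "?u (k + p) = ?v (k + p) + z2"
    using int[of "k - p"] int[of k] int[of "k + p"] by blast
  \<comment> \<open>The three tails of \<open>\<tau>\<close> agree and those of
    \<open>\<delta>\<close> lie in (-1, 1). Three integers that are pairwise at most 1 apart cannot
    all be distinct.\<close>
  have "\<bar>real_of_int (z0 - z1)\<bar> < 2" "\<bar>real_of_int (z0 - z2)\<bar> < 2" "\<bar>real_of_int (z1 - z2)\<bar> < 2"
    using abs_tail_less_1[OF n D inf \<delta>, of "k - p"] abs_tail_less_1[OF n D inf \<delta>, of k]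
      abs_tail_less_1[OF n D inf \<delta>, of "k + p"] z vs by linarith+
  then have "z0 = z1 \<or> z0 = z2 \<or> z1 = z2" by linarith
  \<comment> \<open>The outer two cases give period \<open>p\<close>; the middle one gives only
    \<open>2 * p\<close>, which is why the base is \<open>n ^ (2 * p)\<close>.\<close>
  then consider "?u (k - p) = ?u k" | "?u (k - p) = ?u (k + p)" | "?u k = ?u (k + p)"
    using z vs by auto
  then show ?thesis
  proof cases
    case 1
    note e = expands_diff_tails_eq[OF n D inf \<delta> 1]
    show ?thesis using e[of "p + i"] e[of "2 * p + i"] i pk by (simp add: algebra_simps)
  next
    case 2
    show ?thesis using expands_diff_tails_eq[OF n D inf \<delta> 2, of "p + i"] i pk
      by (simp add: mult_2 add_ac)
  next
    case 3
    note e = expands_diff_tails_eq[OF n D inf \<delta> 3]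
    show ?thesis using e[of i] e[of "p + i"] i by (simp add: mult_2 add_ac)
  qed
qed

text \<open>Uniqueness serves the inclusion from left to right: for a point with digits
  \<open>x\<close> whose translate back has digits \<open>y\<close>, it forces
  \<open>x i - y i = \<delta> i\<close>. Conversely, \<open>x i - \<delta> i\<close> are digits of
  the point moved back by \<open>t\<close>.\<close>

lemma intersection_translate_eq_digit_expansions:
  assumes n: "2 \<le> n" and D: "digit_set n D"
    and \<delta>: "expands_diff n D t \<delta>"
    and unique: "\<And>\<epsilon> i. expands_diff n D t \<epsilon> \<Longrightarrow> 1 \<le> i \<Longrightarrow> \<delta> i = \<epsilon> i"
  shows "cantor_set n D \<inter> translate t (cantor_set n D) =
    digit_expansions n (\<lambda>i. {d \<in> D. d - \<delta> i \<in> D})"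
proof (intro equalityI subsetI)
  fix a assume a: "a \<in> cantor_set n D \<inter> translate t (cantor_set n D)"
  obtain x y where xy: "a = expansion n x" "\<And>i. 1 \<le> i \<Longrightarrow> x i \<in> D" "\<And>i. 1 \<le> i \<Longrightarrow> y i \<in> D"
    and ex: "expands_diff n D t (\<lambda>i. x i - y i)"
    using intersection_translateE[OF n D a] by metis
  then show "a \<in> digit_expansions n (\<lambda>i. {d \<in> D. d - \<delta> i \<in> D})"
    using unique[OF ex] by (auto simp: digit_expansions_def)
next
  fix a assume "a \<in> digit_expansions n (\<lambda>i. {d \<in> D. d - \<delta> i \<in> D})"
  then obtain x where a: "a = expansion n x"
    and x: "\<And>i. 1 \<le> i \<Longrightarrow> x i \<in> D" "\<And>i. 1 \<le> i \<Longrightarrow> x i - \<delta> i \<in> D"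
    by (auto simp: digit_expansions_def)
  have "bounded_digits n x" using x(1) D by (force simp: digit_set_def)
  from expansion_diff[OF n this expands_diff_bound[OF D \<delta>]] \<delta>
  have "a = expansion n (\<lambda>i. x i - \<delta> i) + t" by (simp add: a expands_diff_def)
  moreover have "expansion n (\<lambda>i. x i - \<delta> i) \<in> cantor_set n D"
    unfolding cantor_set_def using x(2) by blast
  moreover have "a \<in> cantor_set n D" unfolding cantor_set_def using a x(1) by blast
  ultimately show "a \<in> cantor_set n D \<inter> translate t (cantor_set n D)"
    by (auto simp: translate_def)
qed

section \<open>Separation of the translates and assembly of the decomposition\<close>

lemma disjoint_translate_convex_hulls:
  fixes A :: "real set"
  assumes "A \<subseteq> {0..w}" and "\<And>s s'. s \<in> S \<Longrightarrow> s' \<in> S \<Longrightarrow> s \<noteq> s' \<Longrightarrow> w < \<bar>s - s'\<bar>"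
  shows "disjoint_family_on (\<lambda>s. translate s A) S"
    and "disjoint_family_on (\<lambda>s. translate s (convex hull A)) S"
proof -
  \<comment> \<open>An interval is convex, so the hull stays inside it; shifts more than
    \<open>w\<close> apart then cannot overlap.\<close>
  have "convex hull A \<subseteq> {0..w}" using assms(1) by (simp add: hull_minimal)
  then have b: "0 \<le> x \<and> x \<le> w" if "x \<in> convex hull A" for x using that by auto
  show hull: "disjoint_family_on (\<lambda>s. translate s (convex hull A)) S"
    unfolding disjoint_family_on_def
  proof (intro ballI impI)
    fix s s' assume s: "s \<in> S" "s' \<in> S" "s \<noteq> s'"
    have False if "x \<in> convex hull A" "y \<in> convex hull A" "x + s = y + s'" for x y
      using b[OF that(1)] b[OF that(2)] that(3) assms(2)[OF s] by linarith
    then show "translate s (convex hull A) \<inter> translate s' (convex hull A) = {}"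
      by (auto simp: translate_def)
  qed
  show "disjoint_family_on (\<lambda>s. translate s A) S"
    unfolding disjoint_family_on_def
  proof (intro ballI impI)
    fix s s' assume s: "s \<in> S" "s' \<in> S" "s \<noteq> s'"
    have "translate r A \<subseteq> translate r (convex hull A)" for r
      unfolding translate_def by (intro image_mono hull_subset)
    then show "translate s A \<inter> translate s' A = {}"
      using hull s unfolding disjoint_family_on_def by blast
  qed
qed

lemma cantor_set_singleton_0: "cantor_set M {0} = {0}"
proof (intro equalityI subsetI)
  fix a assume "a \<in> cantor_set M {0}"
  then obtain x where x: "a = expansion M x" "\<And>i. 1 \<le> i \<Longrightarrow> x i = 0"
    by (auto simp: cantor_set_def)
  have "expansion M x = expansion M (\<lambda>_. 0)" by (rule expansion_cong) (rule x(2))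
  then show "a \<in> {0}" by (simp add: x(1))
next
  fix a :: real assume "a \<in> {0}"
  then have "a = expansion M (\<lambda>_. 0)" by simp
  then show "a \<in> cantor_set M {0}" unfolding cantor_set_def by blast
qed

text \<open>Sparsity speaks of differences, so it is applied to \<open>N - N = 0\<close> and
  \<open>N - N'\<close>.\<close>

lemma digit_word_gap:
  assumes "digit_set n D" "sparse_digits D"
    and "\<And>i. F i \<subseteq> D" "N \<in> digit_words n F m" "N' \<in> digit_words n F m" "N \<noteq> N'"
  shows "2 \<le> \<bar>N - N'\<bar>"
proof -
  have "sparse_digits (digit_words n F m)"
    by (rule sparse_digit_words[OF assms(1,2,3)])
  moreover have "N - N \<noteq> N - N'" using assms(6) by simp
  ultimately have "2 \<le> \<bar>(N - N) - (N - N')\<bar>"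
    using difference_setI[OF assms(4,4)] difference_setI[OF assms(4,5)]
    unfolding sparse_digits_def by blast
  then show ?thesis by simp
qed

theorem theorem1p3:
  fixes n k p :: nat and D :: "int set" and t :: real and \<tau> :: "nat \<Rightarrow> int"
  assumes "n \<ge> 3"
    and "digit_set n D" and "0 \<in> D" and "2 \<le> card D" and "card D < n"
    and "sparse_digits D"
    and "t \<in> {0..1}"
    and "cantor_set n D \<inter> translate t (cantor_set n D) \<noteq> {}"
    and "1 \<le> p" and "p \<le> k"
    and "\<forall>j\<ge>1. \<tau> j \<in> {0..<int n}"
    and "\<forall>j>k - p. \<tau> (j + p) = \<tau> j"
    and "t = expansion n \<tau>"
  shows "\<exists>E. digit_set (n ^ (2 * p)) E \<and> sparse_digits E \<and>
    (\<exists>S :: real set. finite S \<and>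
      normalized_intersection (cantor_set n D) t =
        (\<Union>s\<in>S. translate s (scaled_cantor_set n k (n ^ (2 * p)) E)) \<and>
      disjoint_family_on
        (\<lambda>s. translate s (scaled_cantor_set n k (n ^ (2 * p)) E)) S \<and>
      disjoint_family_on
        (\<lambda>s. translate s (convex hull (scaled_cantor_set n k (n ^ (2 * p)) E))) S)"
proof -
  define C where "C = cantor_set n D"
  define I where "I = C \<inter> translate t C"
  have n: "2 \<le> n" using assms(1) by simp
  have norm: "normalized_intersection C t = translate (- Inf I) I"
    by (simp add: normalized_intersection_def I_def)
  show ?thesis
  proof (cases "finite I")
    case True
    \<comment> \<open>In the finite case the scaled set is a single point, so the points of
      \<open>C(t)\<close> themselves serve as the translation amounts.\<close>
    have A: "scaled_cantor_set n k (n ^ (2 * p)) {0} = {0}"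
      by (simp add: scaled_cantor_set_def cantor_set_singleton_0)
    have "digit_set (n ^ (2 * p)) {0}" "sparse_digits {0}"
      using n by (auto simp: digit_set_def sparse_digits_def difference_set_def)
    moreover have "finite (normalized_intersection C t)"
      using True norm by (simp add: translate_def)
    moreover have "translate s {0} = {s}" for s by (simp add: translate_def)
    ultimately show ?thesis unfolding C_def[symmetric]
      by (intro exI[of _ "{0}"] conjI exI[of _ "normalized_intersection C t"])
        (simp_all add: A disjoint_family_on_def)
  next
    case False
    then have inf: "infinite (cantor_set n D \<inter> translate t (cantor_set n D))"
      by (simp add: I_def C_def)
    obtain \<delta> where \<delta>: "expands_diff n D t \<delta>"
      using assms(8) intersection_translateE[OF n assms(2)] by blast
    define F where "F i = {d \<in> D. d - \<delta> i \<in> D}" for i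
    have FD: "F i \<subseteq> D" for i by (auto simp: F_def)
    then have Fn: "F i \<subseteq> {0..<int n}" for i using assms(2) by (auto simp: digit_set_def)
    \<comment> \<open>If \<open>\<delta> i = a - b\<close> with \<open>a\<close> and
      \<open>b\<close> in \<open>D\<close>, then \<open>a\<close> belongs to
      \<open>F i\<close>.\<close>
    have Fne: "F i \<noteq> {}" if "1 \<le> i" for i
      using \<delta> that by (force simp: F_def expands_diff_def difference_set_def)
    have Fper: "F (k + (i + 2 * p)) = F (k + i)" if "1 \<le> i" for i
      unfolding F_def
      using expands_diff_periodic[OF n assms(2,6) inf \<delta> assms(10) _ _ assms(13) that]
        assms(11,12) by simp
    have I: "I = digit_expansions n F"
      using intersection_translate_eq_digit_expansions[OF n assms(2) \<delta>]
        expands_diff_unique[OF n assms(2,6) inf \<delta>]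
      unfolding I_def C_def F_def by blast
    \<comment> \<open>\<open>?E\<close> collects the words on the first period block after position
      \<open>k\<close>, \<open>?W\<close> the prefixes of length \<open>k\<close>. Each prefix
      contributes one translate, shifted by \<open>- Inf I\<close> as the normalization
      requires.\<close>
    let ?E = "digit_words n (\<lambda>i. F (k + i)) (2 * p)"
    let ?W = "digit_words n F k"
    let ?A = "scaled_cantor_set n k (n ^ (2 * p)) ?E"
    let ?S = "(\<lambda>N. real_of_int N / real n ^ k - Inf I) ` ?W"
    have CE: "cantor_set (n ^ (2 * p)) ?E = digit_expansions n (\<lambda>i. F (k + i))"
      by (rule cantor_set_digit_words[OF n]) (use assms(9) Fn Fper in auto)
    have fin: "finite ?W"
    proof (rule finite_subset)
      have "digit_set (n ^ k) ?W" by (rule digit_set_digit_words) (use Fn Fne in auto)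
      then show "?W \<subseteq> {0..<int (n ^ k)}" by (simp add: digit_set_def)
    qed simp
    have un: "translate (- Inf I) I = (\<Union>s\<in>?S. translate s ?A)"
    proof -
      have "(real_of_int N + c) / real n ^ k + - Inf I =
          1 / real n ^ k * c + (real_of_int N / real n ^ k - Inf I)" for N c
        by (simp add: add_divide_distrib)
      moreover have "I = (\<Union>N\<in>?W. (\<lambda>c. (real_of_int N + c) / real n ^ k) `
          digit_expansions n (\<lambda>i. F (k + i)))"
        using digit_expansions_split[where F = F and m = k, OF n Fn] unfolding I by blast
      then have "translate r I = translate r (\<Union>N\<in>?W.
          (\<lambda>c. (real_of_int N + c) / real n ^ k) ` digit_expansions n (\<lambda>i. F (k + i)))" for r
        by (rule arg_cong)
      then have "translate (- Inf I) I = (\<Union>N\<in>?W.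
          (\<lambda>c. (real_of_int N + c) / real n ^ k + - Inf I) ` digit_expansions n (\<lambda>i. F (k + i)))"
        by (simp only: translate_def image_UN image_image)
      ultimately show ?thesis
        by (simp add: translate_def scaled_cantor_set_def CE image_image add_diff_eq)
    qed
    have A: "?A \<subseteq> {0..1 / real n ^ k}"
    proof
      fix a assume "a \<in> ?A"
      then obtain c where "a = c / real n ^ k" "c \<in> digit_expansions n (\<lambda>i. F (k + i))"
        by (auto simp: scaled_cantor_set_def CE)
      moreover have "c \<in> {0..1}"
        using calculation(2) digit_expansions_subset[where F = "\<lambda>i. F (k + i)", OF n Fn] by blast
      ultimately show "a \<in> {0..1 / real n ^ k}" using n by (simp add: divide_right_mono)
    qed
    \<comment> \<open>Distinct prefixes differ by at least 2, so the translation amounts are at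
      least \<open>2 / n ^ k\<close> apart, while the scaled set fits in an interval of length
      \<open>1 / n ^ k\<close>.\<close>
    have gap: "1 / real n ^ k < \<bar>s - s'\<bar>" if S: "s \<in> ?S" "s' \<in> ?S" "s \<noteq> s'" for s s'
    proof -
      obtain N N' where N: "N \<in> ?W" "N' \<in> ?W" "N \<noteq> N'"
        and s: "s = real_of_int N / real n ^ k - Inf I" "s' = real_of_int N' / real n ^ k - Inf I"
        using S by blast
      have "2 \<le> \<bar>N - N'\<bar>"
        by (rule digit_word_gap[OF assms(2,6) FD N])
      then have "1 < \<bar>real_of_int (N - N')\<bar>" by linarith
      moreover have "s - s' = real_of_int (N - N') / real n ^ k"
        by (simp add: s diff_divide_distrib)
      ultimately show ?thesis using n by (simp add: abs_divide divide_strict_right_mono)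
    qed
    have "digit_set (n ^ (2 * p)) ?E" by (rule digit_set_digit_words) (use Fn Fne in auto)
    moreover have "sparse_digits ?E" by (rule sparse_digit_words[OF assms(2,6) FD])
    moreover have "finite ?S" using fin by simp
    moreover note un disjoint_translate_convex_hulls[OF A gap]
    ultimately show ?thesis unfolding C_def[symmetric] norm
      by (intro exI[of _ ?E] conjI exI[of _ ?S])
  qed
qed

end
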